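(* Let $\alpha\in(0,1)$, let $\mathcal{F}$ be a class of Borel probability measures on $\mathbb{R}$, and let $\mathsf{A}=\{[a,b] : a,b\in\mathbb{R},\ a\le b\}$. Let $w_1,w_2$ be nonnegative weights, let $g_1,g_2:\mathbb{R}\to\mathbb{R}$ be non-constant, non-decreasing, $\mathcal{F}$-integrable functions, and let $S:\mathsf{A}\times\mathbb{R}\to\mathbb{R}$ be of the form \[ S([a,b],y)= w_1\Big(\mathbb{1}\{y\le a\}-\tfrac{\alpha}{2}\Big)\big(g_1(a)-g_1(y)\big)+w_2\Big(\mathbb{1}\{y\le b\}-\big(1-\tfrac{\alpha}{2}\big)\Big)\big(g_2(b)-g_2(y)\big). \] If $S$ is either (i) translation invariant, or (ii) positively homogeneous and differentiable with respect to $(a,b)\in\mathsf{A}\subseteq\mathbb{R}^2$, except possibly along the diagonal, then $g_1$ and $g_2$ are linear (that is, of the form $x\mapsto\gamma x+\delta$ with constants $\gamma,\delta\in\mathbb{R}$). In particular, if $S$ is symmetric and either (i) or (ii) applies, then $S$ is equivalent to the interval score $\mathrm{IS}_\alpha$.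
   Context: A measurable function $h:\mathbb{R}\to\mathbb{R}$ is $\mathcal{F}$-integrable if $\mathbb{E}_F h(Y)$ is well-defined and finite for all $F\in\mathcal{F}$, where $Y$ has distribution $F$ under $\mathbb{E}_F$. $\mathbb{1}\{\cdot\}$ denotes the indicator. In (ii), the set of intervals $\mathsf{A}=\{[a,b]:a\le b\}$ is identified with the subset $\{(a,b)'\in\mathbb{R}^2 : a\le b\}$ of the Euclidean plane; the diagonal is the set of points with $a=b$. A function $S:\mathsf{A}\times\mathbb{R}\to\mathbb{R}$ is called: - translation invariant if $S([a-z,b-z],y-z)=S([a,b],y)$ for all $z,y\in\mathbb{R}$ and $a<b$; - positively homogeneous (of order 1) if $S([ca,cb],cy)=c\,S([a,b],y)$ for all $c>0$, $y\in\mathbb{R}$ and $a<b$; - symmetric if $S([a,b],y)=S([-b,-a],-y)$ for all $y\in\mathbb{R}$ and $a<b$. The (Winkler) interval score is \[ \mathrm{IS}_\alpha([a,b],y)=(b-a)+\tfrac{2}{\alpha}(a-y)\mathbb{1}\{y<a\}+\tfrac{2}{\alpha}(y-b)\mathbb{1}\{y>b\}. \] A scoring function $S'$ on $\mathsf{A}\times\mathbb{R}$ is equivalent to $S$ if $S'(x,y)=c\,S(x,y)+h(y)$ for all $x\in\mathsf{A}$, $y\in\mathbb{R}$, for some $c>0$ and some $\mathcal{F}$-integrable $h:\mathbb{R}\to\mathbb{R}$.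
   Formalization: Linearity of g_i is claimed only when its weight w_i is nonzero, and equivalence to the interval score only when the weights are not both zero (otherwise false); differentiability in (ii) is required only for y different from a and b, a weaker assumption. *)

theory Defs
  imports "HOL-Probability.Distribution_Functions"
begin

text \<open>The interval \<open>[a, b]\<close> is represented by the point \<open>(a, b)\<close> of the plane. Scoring functions are
  total on \<open>real \<times> real\<close>, but every notion below refers to their values on \<open>intervals\<close> only.\<close>

definition intervals :: "(real \<times> real) set" where
  "intervals = {(a, b). a \<le> b}"

text \<open>Measurability is a separate clause because it must also hold when the class is empty.\<close>

definition F_integrable :: "real measure set \<Rightarrow> (real \<Rightarrow> real) \<Rightarrow> bool" where
  "F_integrable \<F> h \<longleftrightarrow> h \<in> borel_measurable borel \<and> (\<forall>F\<in>\<F>. integrable F h)"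

definition translation_invariant :: "(real \<times> real \<Rightarrow> real \<Rightarrow> real) \<Rightarrow> bool" where
  "translation_invariant S \<longleftrightarrow>
     (\<forall>a b y z. a < b \<longrightarrow> S (a - z, b - z) (y - z) = S (a, b) y)"

definition positively_homogeneous :: "(real \<times> real \<Rightarrow> real \<Rightarrow> real) \<Rightarrow> bool" where
  "positively_homogeneous S \<longleftrightarrow>
     (\<forall>a b y c. c > 0 \<longrightarrow> a < b \<longrightarrow> S (c * a, c * b) (c * y) = c * S (a, b) y)"

definition symmetric_score :: "(real \<times> real \<Rightarrow> real \<Rightarrow> real) \<Rightarrow> bool" where
  "symmetric_score S \<longleftrightarrow> (\<forall>a b y. a < b \<longrightarrow> S (a, b) y = S (- b, - a) (- y))"

text \<open>Joint (Frechet) differentiability in \<open>(a, b)\<close>, off the diagonal. The observation \<open>y\<close> is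
  required not to be an endpoint: every score considered here, the interval score included, has a
  kink where \<open>a\<close> or \<open>b\<close> crosses \<open>y\<close>, and demanding differentiability there as well would
  force the functions \<open>g\<^sub>1\<close>, \<open>g\<^sub>2\<close> (with nonzero weight) to be constant. The condition is implied by
  the one without this proviso, see the lemma below.\<close>

definition differentiable_off_diagonal :: "(real \<times> real \<Rightarrow> real \<Rightarrow> real) \<Rightarrow> bool" where
  "differentiable_off_diagonal S \<longleftrightarrow>
     (\<forall>y. \<forall>(a, b)\<in>intervals. a \<noteq> b \<longrightarrow> y \<noteq> a \<longrightarrow> y \<noteq> b \<longrightarrow>
        (\<lambda>x. S x y) differentiable (at (a, b) within intervals))"

lemma differentiable_off_diagonalI:
  assumes "\<And>y a b. a < b \<Longrightarrow> (\<lambda>x. S x y) differentiable (at (a, b) within intervals)"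
  shows "differentiable_off_diagonal S"
  using assms by (auto simp: differentiable_off_diagonal_def intervals_def)

definition interval_score :: "real \<Rightarrow> real \<times> real \<Rightarrow> real \<Rightarrow> real" where
  "interval_score \<alpha> = (\<lambda>(a, b) y.
     (b - a) + 2 / \<alpha> * (a - y) * of_bool (y < a) + 2 / \<alpha> * (y - b) * of_bool (y > b))"

definition equivalent_score ::
  "real measure set \<Rightarrow> (real \<times> real \<Rightarrow> real \<Rightarrow> real) \<Rightarrow> (real \<times> real \<Rightarrow> real \<Rightarrow> real) \<Rightarrow> bool" where
  "equivalent_score \<F> S' S \<longleftrightarrow>
     (\<exists>c h. c > 0 \<and> F_integrable \<F> h \<and> (\<forall>x\<in>intervals. \<forall>y. S' x y = c * S x y + h y))"

definition affine_function :: "(real \<Rightarrow> real) \<Rightarrow> bool" where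
  "affine_function g \<longleftrightarrow> (\<exists>\<gamma> \<delta>. \<forall>x. g x = \<gamma> * x + \<delta>)"

end

theory Submission
  imports Defs
begin

text \<open>Write \<open>G\<^sub>i = w\<^sub>i g\<^sub>i\<close>. For \<open>y\<close> on one side of the interval, moving the
  endpoint farther from \<open>y\<close> leaves both indicators unchanged and changes \<open>S\<close>, up to sign, by \<open>\<alpha> / 2\<close> times
  an increment of \<open>G\<^sub>1\<close> (\<open>y\<close> to the right) or \<open>G\<^sub>2\<close> (\<open>y\<close> to the left). Increments of \<open>G\<^sub>i\<close> therefore inherit the
  invariance of \<open>S\<close>. Translation invariance makes \<open>G\<^sub>i - G\<^sub>i 0\<close> additive, hence linear by monotonicity.
  Homogeneity makes \<open>G\<^sub>i - G\<^sub>i 0\<close> linear on each half-line, and differentiability at \<open>0\<close> makes the two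
  slopes agree. For a symmetric score the slopes of \<open>G\<^sub>1\<close> and \<open>G\<^sub>2\<close> coincide, and
  the score is a multiple of the interval score.\<close>

text \<open>Additivity fixes \<open>f\<close> on the integers. By monotonicity
  \<open>f (n * x)\<close> and \<open>f 1 * (n * x)\<close> both lie between the values of
  \<open>f\<close> at the two integers around \<open>n * x\<close>, which are only
  \<open>f 1\<close> apart. So \<open>n\<close> times the error at \<open>x\<close> stays bounded
  for every \<open>n\<close>, and the error vanishes by the Archimedean property.\<close>

lemma additive_mono_real_linear:
  fixes f :: "real \<Rightarrow> real"
  assumes add: "\<And>x y. f (x + y) = f x + f y" and mono: "mono f"
  shows "f x = f 1 * x"
proof -
  have f0: "f 0 = 0" using add[of 0 0] by simp
  have fn: "f (real n * x) = real n * f x" for n x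
    by (induction n) (simp_all add: f0 add algebra_simps)
  have neg: "f (- x) = - f x" for x using add[of x "-x"] f0 by simp
  have fi: "f (of_int k) = of_int k * f 1" for k
    using fn[of "nat \<bar>k\<bar>" 1] neg[of "real (nat \<bar>k\<bar>)"] by (cases "k \<ge> 0") auto
  have bound: "real n * \<bar>f x - f 1 * x\<bar> \<le> f 1" for n
  proof -
    let ?t = "real n * x"
    have f1: "f 1 \<ge> 0" using monoD[OF mono, of 0 1] f0 by simp
    have "of_int \<lfloor>?t\<rfloor> * f 1 \<le> f ?t"
      using monoD[OF mono, of "of_int \<lfloor>?t\<rfloor>" ?t] fi by simp
    moreover have "f ?t \<le> (of_int \<lfloor>?t\<rfloor> + 1) * f 1"
      using monoD[OF mono, of ?t "of_int (\<lfloor>?t\<rfloor> + 1)"] fi[of "\<lfloor>?t\<rfloor> + 1"]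
      real_of_int_floor_add_one_ge[of ?t] by simp
    moreover have "of_int \<lfloor>?t\<rfloor> * f 1 \<le> ?t * f 1" "?t * f 1 \<le> (of_int \<lfloor>?t\<rfloor> + 1) * f 1"
      using f1 by (auto intro!: mult_right_mono)
    ultimately have "\<bar>f ?t - ?t * f 1\<bar> \<le> f 1" by (simp add: algebra_simps)
    moreover have "f ?t - ?t * f 1 = real n * (f x - f 1 * x)" unfolding fn by (simp add: algebra_simps)
    ultimately show ?thesis by (simp add: abs_mult)
  qed
  show ?thesis
  proof (rule ccontr)
    assume "f x \<noteq> f 1 * x"
    then obtain n where "f 1 < real n * \<bar>f x - f 1 * x\<bar>"
      using reals_Archimedean3[of "\<bar>f x - f 1 * x\<bar>"] by auto
    with bound[of n] show False by simp
  qed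
qed

lemma affine_if_mono_translation_invariant_increments:
  assumes "mono g" and inv: "\<And>x y z. g (x - z) - g (y - z) = g x - g y"
  shows "affine_function g"
proof -
  have "g x - g 0 = (g 1 - g 0) * x" for x
  proof (rule additive_mono_real_linear)
    show "g (x + y) - g 0 = (g x - g 0) + (g y - g 0)" for x y
      using inv[of "x + y" y y] by simp
    show "mono (\<lambda>x. g x - g 0)" using \<open>mono g\<close> by (simp add: mono_def)
  qed
  then have "g x = (g 1 - g 0) * x + g 0" for x by (simp add: algebra_simps)
  then show ?thesis unfolding affine_function_def by blast
qed

text \<open>Homogeneity keeps the difference quotient at 0 constant along the sequence
  \<open>x / (n + 1)\<close>, which tends to 0. Its value \<open>(g x - g 0) / x\<close> is
  therefore the derivative \<open>D\<close>, for either sign of \<open>x\<close>.\<close>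

lemma affine_if_homogeneous_increments:
  assumes hom: "\<And>c x y. c > 0 \<Longrightarrow> g (c * x) - g (c * y) = c * (g x - g y)"
    and diff: "g differentiable (at 0)"
  shows "affine_function g"
proof -
  obtain D where D: "(g has_real_derivative D) (at 0)"
    using diff real_differentiable_def by blast
  have "g x = D * x + g 0" for x
  proof (cases "x = 0")
    case False
    have "(\<lambda>h. (g h - g 0) / h) \<midarrow>0\<rightarrow> D"
      using D by (simp add: DERIV_def)
    moreover have "filterlim (\<lambda>n. inverse (real (Suc n)) * x) (at 0) sequentially"
    proof -
      have "(\<lambda>n. inverse (real (Suc n)) * x) \<longlonglongrightarrow> 0 * x"
        by (intro tendsto_intros LIMSEQ_inverse_real_of_nat)
      then show ?thesis using False by (simp add: filterlim_at)
    qed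
    ultimately have "(\<lambda>n. (g (inverse (real (Suc n)) * x) - g 0) / (inverse (real (Suc n)) * x)) \<longlonglongrightarrow> D"
      by (rule filterlim_compose)
    moreover have "(g (inverse (real (Suc n)) * x) - g 0) / (inverse (real (Suc n)) * x) = (g x - g 0) / x" for n
      using hom[of "inverse (real (Suc n))" x 0] by simp
    ultimately have "(\<lambda>n. (g x - g 0) / x) \<longlonglongrightarrow> D" by simp
    then have "(g x - g 0) / x = D" by (simp add: LIMSEQ_const_iff)
    then show ?thesis using False by (simp add: field_simps)
  qed simp
  then show ?thesis unfolding affine_function_def by blast
qed

text \<open>Passes from joint differentiability within a set to one moving endpoint. The curve has
  to stay in \<open>A\<close> only for parameters in an open neighbourhood \<open>T\<close> of
  0.\<close>

lemma differentiable_along_line: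
  fixes f :: "real \<times> real \<Rightarrow> real" and p :: "real \<Rightarrow> real \<times> real"
  assumes "f differentiable (at (p 0) within A)" "p differentiable (at 0)"
    and "open T" "0 \<in> T" "p ` T \<subseteq> A"
  shows "(\<lambda>t. f (p t)) differentiable (at 0)"
proof -
  have "(f \<circ> p) differentiable (at 0 within T)"
    using assms
    by (intro differentiable_chain_within)
      (auto intro: differentiable_within_subset differentiable_at_withinI)
  then show ?thesis
    using at_within_open[OF \<open>0 \<in> T\<close> \<open>open T\<close>] by (simp add: o_def)
qed

lemma affine_if_affine_cmult:
  assumes "affine_function (\<lambda>x. w * g x)" "w \<noteq> 0"
  shows "affine_function g"
proof -
  obtain \<gamma> \<delta> where "\<And>x. w * g x = \<gamma> * x + \<delta>"
    using assms(1) unfolding affine_function_def by blast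
  then have "g x = (\<gamma> / w) * x + \<delta> / w" for x using \<open>w \<noteq> 0\<close> by (simp add: field_simps)
  then show ?thesis unfolding affine_function_def by blast
qed

theorem theorem3p1:
  fixes \<alpha> w1 w2 :: real
    and \<F> :: "real measure set"
    and g1 g2 :: "real \<Rightarrow> real"
    and S :: "real \<times> real \<Rightarrow> real \<Rightarrow> real"
  assumes "0 < \<alpha>" "\<alpha> < 1"
    and "\<And>F. F \<in> \<F> \<Longrightarrow> real_distribution F"
    and "w1 \<ge> 0" "w2 \<ge> 0"
    and "\<not> g1 constant_on UNIV" "mono g1" "F_integrable \<F> g1"
    and "\<not> g2 constant_on UNIV" "mono g2" "F_integrable \<F> g2"
    and "\<And>a b y. (a, b) \<in> intervals \<Longrightarrow>
           S (a, b) y = w1 * (of_bool (y \<le> a) - \<alpha> / 2) * (g1 a - g1 y)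
                      + w2 * (of_bool (y \<le> b) - (1 - \<alpha> / 2)) * (g2 b - g2 y)"
    and "translation_invariant S \<or> (positively_homogeneous S \<and> differentiable_off_diagonal S)"
  shows "(w1 \<noteq> 0 \<longrightarrow> affine_function g1) \<and> (w2 \<noteq> 0 \<longrightarrow> affine_function g2) \<and>
         (symmetric_score S \<and> (w1 \<noteq> 0 \<or> w2 \<noteq> 0) \<longrightarrow> equivalent_score \<F> S (interval_score \<alpha>))"
proof -
  \<comment> \<open>With the weights absorbed, a zero weight needs no separate case: the
    corresponding function is constant, hence affine. Weights are divided out only at the
    end.\<close>
  define G1 G2 where "G1 = (\<lambda>x. w1 * g1 x)" and "G2 = (\<lambda>x. w2 * g2 x)"
  have S: "S (a, b) y = (of_bool (y \<le> a) - \<alpha> / 2) * (G1 a - G1 y)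
             + (of_bool (y \<le> b) - (1 - \<alpha> / 2)) * (G2 b - G2 y)" if "a \<le> b" for a b y
  proof -
    have "w * c * (u - v) = c * (w * u - w * v)" for w c u v :: real
      by (simp add: algebra_simps)
    moreover have "(a, b) \<in> intervals" using that by (simp add: intervals_def)
    ultimately show ?thesis unfolding G1_def G2_def by (simp only: assms(12))
  qed
  have mono: "mono G1" "mono G2"
    using assms(4,5,7,10) by (auto simp: G1_def G2_def mono_def intro: mult_left_mono)
  have incr1: "S (x, b) y - S (x', b) y = \<alpha> / 2 * (G1 x' - G1 x)"
    if "x < b" "x' < b" "b < y" for x x' b y
    using that by (simp add: S field_simps)
  \<comment> \<open>The case \<open>y = a\<close> is allowed: the indicator at the right endpoint is
    still 1, and the left-endpoint term cancels.\<close>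
  have incr2: "S (a, x) y - S (a, x') y = \<alpha> / 2 * (G2 x - G2 x')"
    if "a < x" "a < x'" "y \<le> a" for x x' a y
    using that by (simp add: S field_simps)
  have "affine_function G1 \<and> affine_function G2"
    using assms(13)
  proof (elim disjE conjE)
    assume "translation_invariant S"
    then have inv: "S (a - z, b - z) (y - z) = S (a, b) y" if "a < b" for a b y z
      using that unfolding translation_invariant_def by blast
    have "G1 (x - z) - G1 (x' - z) = G1 x - G1 x'" for x x' z
    proof -
      \<comment> \<open>A common right endpoint strictly beyond both points makes both intervals
        nondegenerate, as invariance requires; \<open>b + 1\<close> is then an observation to their
        right.\<close>
      define b where "b = max x x' + 1"
      have "x < b" "x' < b" by (auto simp: b_def)
      then have "\<alpha> / 2 * (G1 (x' - z) - G1 (x - z)) = \<alpha> / 2 * (G1 x' - G1 x)"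
        using incr1[of x b x' "b + 1"] incr1[of "x - z" "b - z" "x' - z" "b + 1 - z"]
          inv[of x b z "b + 1"] inv[of x' b z "b + 1"] by auto
      then show ?thesis using \<open>0 < \<alpha>\<close> by simp
    qed
    moreover have "G2 (x - z) - G2 (x' - z) = G2 x - G2 x'" for x x' z
    proof -
      define a where "a = min x x' - 1"
      have "a < x" "a < x'" by (auto simp: a_def)
      then have "\<alpha> / 2 * (G2 (x - z) - G2 (x' - z)) = \<alpha> / 2 * (G2 x - G2 x')"
        using incr2[of a x x' a] incr2[of "a - z" "x - z" "x' - z" "a - z"]
          inv[of a x z a] inv[of a x' z a] by auto
      then show ?thesis using \<open>0 < \<alpha>\<close> by simp
    qed
    ultimately show ?thesis
      using affine_if_mono_translation_invariant_increments mono by blast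
  next
    assume "positively_homogeneous S"
    then have hom: "S (c * a, c * b) (c * y) = c * S (a, b) y" if "0 < c" "a < b" for a b c y
      using that unfolding positively_homogeneous_def by blast
    assume "differentiable_off_diagonal S"
    then have diff: "(\<lambda>x. S x y) differentiable (at (a, b) within intervals)"
      if "a < b" "y \<noteq> a" "y \<noteq> b" for a b y
      using that unfolding differentiable_off_diagonal_def intervals_def by fastforce
    have "G1 (c * x) - G1 (c * x') = c * (G1 x - G1 x')" if "0 < c" for c x x'
    proof -
      define b where "b = max x x' + 1"
      have b: "x < b" "x' < b" by (auto simp: b_def)
      have "\<alpha> / 2 * (G1 (c * x') - G1 (c * x)) = S (c * x, c * b) (c * (b + 1)) - S (c * x', c * b) (c * (b + 1))"
        using b that by (intro incr1[symmetric]) auto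
      also have "\<dots> = c * (S (x, b) (b + 1) - S (x', b) (b + 1))"
        using hom b that by (simp add: right_diff_distrib)
      also have "\<dots> = c * (\<alpha> / 2 * (G1 x' - G1 x))" using incr1 b by simp
      finally have "\<alpha> / 2 * (G1 (c * x') - G1 (c * x)) = \<alpha> / 2 * (c * (G1 x' - G1 x))"
        by (simp only: mult.left_commute)
      then have "G1 (c * x') - G1 (c * x) = c * (G1 x' - G1 x)"
        using \<open>0 < \<alpha>\<close> by (subst (asm) mult_cancel_left) simp
      then show ?thesis by (simp add: algebra_simps)
    qed
    moreover have "G1 differentiable (at 0)"
    proof -
      \<comment> \<open>The base point \<open>(0, 1)\<close> is off the diagonal and 2 is not an
        endpoint; \<open>(t, 1)\<close> is an interval for all \<open>t < 1\<close>.\<close>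
      have "(\<lambda>t. S (t, 1) 2) differentiable (at 0)"
        using diff[of 0 1 2]
        by (intro differentiable_along_line[of "\<lambda>x. S x 2" "\<lambda>t. (t, 1)" intervals "{..<1}"])
          (auto simp: intervals_def intro!: differentiable_Pair)
      \<comment> \<open>This is \<open>incr1\<close> solved for \<open>G1 t\<close>; it agrees with
        \<open>G1\<close> whenever \<bar>t\<bar> < 1, hence the radius below.\<close>
      then have "(\<lambda>t. G1 0 - 2 / \<alpha> * (S (t, 1) 2 - S (0, 1) 2)) differentiable (at 0)"
        by (intro derivative_intros)
      then show ?thesis
        by (rule differentiable_transform_within[where d = 1])
          (use \<open>0 < \<alpha>\<close> in \<open>auto simp: incr1 dist_real_def field_simps\<close>)
    qed
    moreover have "G2 (c * x) - G2 (c * x') = c * (G2 x - G2 x')" if "0 < c" for c x x'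
    proof -
      define a where "a = min x x' - 1"
      have a: "a < x" "a < x'" by (auto simp: a_def)
      have "\<alpha> / 2 * (G2 (c * x) - G2 (c * x')) = S (c * a, c * x) (c * a) - S (c * a, c * x') (c * a)"
        using a that by (intro incr2[symmetric]) auto
      also have "\<dots> = c * (S (a, x) a - S (a, x') a)"
        using hom a that by (simp add: right_diff_distrib)
      also have "\<dots> = c * (\<alpha> / 2 * (G2 x - G2 x'))" using incr2 a by simp
      finally have "\<alpha> / 2 * (G2 (c * x) - G2 (c * x')) = \<alpha> / 2 * (c * (G2 x - G2 x'))"
        by (simp only: mult.left_commute)
      then show ?thesis
        using \<open>0 < \<alpha>\<close> by (subst (asm) mult_cancel_left) simp
    qed
    moreover have "G2 differentiable (at 0)"
    proof -
      have "(\<lambda>t. S (- 1, t) (- 2)) differentiable (at 0)"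
        using diff[of "- 1" 0 "- 2"]
        by (intro differentiable_along_line[of "\<lambda>x. S x (- 2)" "\<lambda>t. (- 1, t)" intervals "{- 1<..}"])
          (auto simp: intervals_def intro!: differentiable_Pair)
      then have "(\<lambda>t. G2 0 + 2 / \<alpha> * (S (- 1, t) (- 2) - S (- 1, 0) (- 2))) differentiable (at 0)"
        by (intro derivative_intros)
      then show ?thesis
        by (rule differentiable_transform_within[where d = 1])
          (use \<open>0 < \<alpha>\<close> in \<open>auto simp: incr2 dist_real_def field_simps\<close>)
    qed
    ultimately show ?thesis using affine_if_homogeneous_increments by blast
  qed
  then have aff: "affine_function G1" "affine_function G2" by auto
  have "equivalent_score \<F> S (interval_score \<alpha>)"
    if "symmetric_score S" and w: "w1 \<noteq> 0 \<or> w2 \<noteq> 0"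
  proof -
    have sym: "S (a, b) y = S (- b, - a) (- y)" if "a < b" for a b y
      using \<open>symmetric_score S\<close> that unfolding symmetric_score_def by blast
    obtain \<gamma>1 \<delta>1 where G1: "\<And>x. G1 x = \<gamma>1 * x + \<delta>1"
      using aff(1) unfolding affine_function_def by blast
    obtain \<gamma>2 \<delta>2 where G2: "\<And>x. G2 x = \<gamma>2 * x + \<delta>2"
      using aff(2) unfolding affine_function_def by blast
    \<comment> \<open>Symmetry equates two affine functions of \<open>a\<close>. Subtracting their
      equality at 1/2 from that at 1 removes the constant terms and leaves equal slopes.\<close>
    have "S (a, 2) 0 = (1 - \<alpha> / 2) * \<gamma>1 * a + \<alpha> * \<gamma>2"
      "S (- 2, - a) 0 = \<alpha> * \<gamma>1 + (1 - \<alpha> / 2) * \<gamma>2 * a" if "0 < a" "a < 2" for a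
      using that by (simp_all add: S G1 G2 algebra_simps)
    from this[of 1] this[of "1 / 2"] have "(1 - \<alpha> / 2) * \<gamma>1 = (1 - \<alpha> / 2) * \<gamma>2"
      using sym[of 1 2 0] sym[of "1 / 2" 2 0] by (simp add: algebra_simps)
    then have eq: "\<gamma>2 = \<gamma>1" using \<open>\<alpha> < 1\<close> by simp
    have "\<gamma>1 \<ge> 0" using monoD[OF mono(1), of 0 1] by (simp add: G1)
    moreover have "\<gamma>1 \<noteq> 0"
    proof
      \<comment> \<open>Both \<open>G1\<close> and \<open>G2\<close> are then constant, so the
        \<open>g\<close> with nonzero weight is constant, a contradiction.\<close>
      assume "\<gamma>1 = 0"
      then have "w1 * g1 x = \<delta>1" "w2 * g2 x = \<delta>2" for x
        using G1[of x] G2[of x] eq by (simp_all add: G1_def G2_def)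
      then have "w1 \<noteq> 0 \<Longrightarrow> g1 x = \<delta>1 / w1" "w2 \<noteq> 0 \<Longrightarrow> g2 x = \<delta>2 / w2" for x
        by (simp_all add: nonzero_eq_divide_eq mult.commute)
      with w assms(6,9) show False unfolding constant_on_def by blast
    qed
    ultimately have "\<gamma>1 > 0" by simp
    \<comment> \<open>The factor is read off for \<open>y\<close> inside the interval, where the two
      terms add up to \<alpha> / 2 times the slope times the width. Strict and weak indicators agree
      here, since each term they govern vanishes when \<open>y\<close> is that endpoint. The summand
      0 plays the part of \<open>h\<close>.\<close>
    have "S (a, b) y = \<alpha> / 2 * \<gamma>1 * interval_score \<alpha> (a, b) y + 0" if "a \<le> b" for a b y
      using that \<open>0 < \<alpha>\<close>
      by (cases y a rule: linorder_cases; cases y b rule: linorder_cases)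
        (simp_all add: S G1 G2 eq interval_score_def field_simps)
    moreover have "F_integrable \<F> (\<lambda>_. 0)" by (simp add: F_integrable_def)
    moreover have "\<alpha> / 2 * \<gamma>1 > 0" using \<open>0 < \<alpha>\<close> \<open>\<gamma>1 > 0\<close> by simp
    ultimately show ?thesis
      unfolding equivalent_score_def intervals_def by blast
  qed
  then show ?thesis
    using aff affine_if_affine_cmult unfolding G1_def G2_def by blast
qed

end
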